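(* There exists a testing algorithm for monotonicity of distributions over $[n]$ in the ${\sf EVAL}$ model with query complexity $O\!\left(\max\left(\frac{\log n}{\varepsilon},\frac{1}{\varepsilon^2}\right)\right)$: given $n$, $\varepsilon\in(0,1]$ and ${\sf EVAL}$ access to an unknown distribution $D$ over $[n]$, it outputs ACCEPT with probability at least $2/3$ if $D$ is monotone and REJECT with probability at least $2/3$ if $d_{TV}(D,\mathcal{M})\ge\varepsilon$.
   Context: A distribution over $[n]$ is monotone if $D(1)\ge\dots\ge D(n)$; $\mathcal{M}$ is the class of such distributions; $d_{TV}(D_1,D_2)=\frac12\sum_x|D_1(x)-D_2(x)|$, $d_{TV}(D,\mathcal{M})=\inf_{D'\in\mathcal{M}}d_{TV}(D,D')$. An ${\sf EVAL}$ oracle for $D$ takes as input $x\in[n]$ and returns $D(x)$. *)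

theory Defs
  imports "HOL-Probability.Probability"
begin

definition distributions :: "nat \<Rightarrow> nat pmf set" where
  "distributions n = {D. set_pmf D \<subseteq> {1..n}}"

definition monotone_dists :: "nat \<Rightarrow> nat pmf set" where
  "monotone_dists n = {D \<in> distributions n. \<forall>i\<in>{1..<n}. pmf D i \<ge> pmf D (Suc i)}"

definition d_TV :: "nat \<Rightarrow> nat pmf \<Rightarrow> nat pmf \<Rightarrow> real" where
  "d_TV n D1 D2 = 1/2 * (\<Sum>x\<in>{1..n}. \<bar>pmf D1 x - pmf D2 x\<bar>)"

definition d_TV_class :: "nat \<Rightarrow> nat pmf \<Rightarrow> nat pmf set \<Rightarrow> real" where
  "d_TV_class n D P = (INF D'\<in>P. d_TV n D D')"

datatype verdict = ACCEPT | REJECT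

text \<open>
  An adaptive randomized oracle algorithm is a well-founded decision tree. \<open>Query x k\<close> asks the
  oracle for the value at \<open>x\<close> and continues with \<open>k\<close> applied to the (real) answer; \<open>Sample p k\<close>
  draws from the internal source of randomness \<open>p\<close>, independently of everything drawn before and
  free of charge. The unknown distribution is accessible only through \<open>Query\<close>.
\<close>
datatype eval_alg =
    Output verdict
  | Query nat "real \<Rightarrow> eval_alg"
  | Sample "nat pmf" "nat \<Rightarrow> eval_alg"

text \<open>The joint law of the verdict and the list of points queried, repetitions included.\<close>
primrec run :: "nat pmf \<Rightarrow> eval_alg \<Rightarrow> (verdict \<times> nat list) pmf" where
  "run D (Output v) = return_pmf (v, [])"
| "run D (Query x k) = map_pmf (\<lambda>(v, qs). (v, x # qs)) (run D (k (pmf D x)))"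
| "run D (Sample p k) = bind_pmf p (\<lambda>r. run D (k r))"

definition verdict_prob :: "nat pmf \<Rightarrow> eval_alg \<Rightarrow> verdict \<Rightarrow> real" where
  "verdict_prob D A v = measure_pmf.prob (run D A) {(v', qs). v' = v}"

text \<open>
  The oracle is defined on \<open>[n]\<close> only, so every point that may be queried has to lie in \<open>[n]\<close>. The
  number of queries is bounded in the worst case, over all distributions on \<open>[n]\<close> and all outcomes
  of the internal randomness.
\<close>
definition legal_queries :: "nat \<Rightarrow> eval_alg \<Rightarrow> bool" where
  "legal_queries n A \<longleftrightarrow> (\<forall>D\<in>distributions n. \<forall>(v, qs)\<in>set_pmf (run D A). set qs \<subseteq> {1..n})"

definition queries_at_most :: "nat \<Rightarrow> eval_alg \<Rightarrow> real \<Rightarrow> bool" where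
  "queries_at_most n A q \<longleftrightarrow>
     (\<forall>D\<in>distributions n. \<forall>(v, qs)\<in>set_pmf (run D A). real (length qs) \<le> q)"

text \<open>A property \<open>P\<close> assigns to each domain size \<open>n\<close> a class of distributions over \<open>[n]\<close>.\<close>
definition eval_tester :: "(nat \<Rightarrow> nat pmf set) \<Rightarrow> (nat \<Rightarrow> real \<Rightarrow> eval_alg) \<Rightarrow> bool" where
  "eval_tester P T \<longleftrightarrow>
     (\<forall>n \<epsilon>. n \<ge> 1 \<and> 0 < \<epsilon> \<and> \<epsilon> \<le> 1 \<longrightarrow>
        legal_queries n (T n \<epsilon>) \<and>
        (\<forall>D\<in>distributions n.
           (D \<in> P n \<longrightarrow> verdict_prob D (T n \<epsilon>) ACCEPT \<ge> 2/3) \<and>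
           (d_TV_class n D (P n) \<ge> \<epsilon> \<longrightarrow> verdict_prob D (T n \<epsilon>) REJECT \<ge> 2/3)))"

end

theory Submission
  imports Defs
begin

text \<open>
  Put \<open>\<alpha> = \<epsilon>/2\<close> and query \<open>D\<close> at \<open>n\<close> and at the points \<open>\<lceil>(1+\<alpha>)^i\<rceil> \<le> n\<close>. Let \<open>f\<close> be the step
  function whose value at \<open>x\<close> is the value of \<open>D\<close> at the first queried point not below \<open>x\<close>. If \<open>D\<close> is
  monotone, then \<open>f\<close> is nonincreasing, \<open>f \<le> D\<close>, and the mass of \<open>f\<close> is at least \<open>1 - \<alpha>\<close> by a
  layer-cake argument. So reject if \<open>f\<close> is not nonincreasing or has mass below \<open>1 - \<alpha>\<close>; otherwise
  draw \<open>O(1/\<epsilon>)\<close> points from the normalisation of \<open>f\<close>, which is a known distribution, and reject if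
  one of them satisfies \<open>D(x) < f(x)\<close>. A monotone \<open>D\<close> is always accepted. The normalisation of \<open>f\<close> is
  itself monotone, hence at distance at least \<open>\<epsilon>\<close> from \<open>D\<close> if \<open>D\<close> is \<open>\<epsilon>\<close>-far from monotone, and this
  forces the set where \<open>D < f\<close> to have probability at least \<open>\<epsilon> - \<alpha>\<close>.
\<close>

lemma pmf_sum_eq_1:
  assumes "D \<in> distributions n"
  shows "(\<Sum>x\<in>{1..n}. pmf D x) = 1"
  using assms by (intro sum_pmf_eq_1) (auto simp: distributions_def)

lemma antimono_from_steps:
  fixes g :: "nat \<Rightarrow> real"
  assumes "\<forall>i\<in>{1..<n}. g i \<ge> g (Suc i)" "1 \<le> x" "x \<le> y" "y \<le> n"
  shows "g y \<le> g x"
  using assms(3,4)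
proof (induction rule: dec_induct)
  case (step k)
  with assms(1,2) have "g (Suc k) \<le> g k" by auto
  with step show ?case by auto
qed simp

subsection \<open>The step function below a monotone distribution\<close>

definition next_point :: "nat set \<Rightarrow> nat \<Rightarrow> nat" where
  "next_point B x = (LEAST b. b \<in> B \<and> x \<le> b)"

lemma next_point:
  assumes "n \<in> B" "x \<le> n"
  shows "next_point B x \<in> B" "x \<le> next_point B x" "next_point B x \<le> n"
  using LeastI[of "\<lambda>b. b \<in> B \<and> x \<le> b" n] Least_le[of "\<lambda>b. b \<in> B \<and> x \<le> b" n] assms
  by (auto simp: next_point_def)

lemma next_point_le: "b \<in> B \<Longrightarrow> x \<le> b \<Longrightarrow> next_point B x \<le> b"
  unfolding next_point_def by (rule Least_le) auto

lemma next_point_mono: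
  assumes "n \<in> B" "x \<le> y" "y \<le> n"
  shows "next_point B x \<le> next_point B y"
  using assms next_point[of n B y] by (intro next_point_le) auto

text \<open>
  With \<open>d t = g t - g (t + 1)\<close>, the loss is the sum of \<open>d t\<close> times the number of \<open>x \<le> t\<close> having no
  point of \<open>B\<close> in \<open>[x, t]\<close>. That number is at most \<open>\<alpha> t\<close>, while the sum of \<open>t d t\<close> is the mass of \<open>g\<close>.
\<close>
lemma step_function_mass:
  fixes g :: "nat \<Rightarrow> real"
  assumes nB: "n \<in> B"
    and B: "\<And>t. t \<in> {1..n} \<Longrightarrow> \<exists>b\<in>B. b \<le> t \<and> real t - real b \<le> \<alpha> * real t"
    and mono: "\<forall>i\<in>{1..<n}. g i \<ge> g (Suc i)" and nonneg: "\<And>x. 0 \<le> g x"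
  shows "(\<Sum>x\<in>{1..n}. g x) - (\<Sum>x\<in>{1..n}. g (next_point B x)) \<le> \<alpha> * (\<Sum>x\<in>{1..n}. g x)"
proof -
  \<comment> \<open>Cutting \<open>g\<close> off to 0 beyond \<open>n\<close> makes
    \<open>d n = g n\<close>, so that telescoping up to \<open>Suc n\<close> recovers all of
    \<open>g x\<close>.\<close>
  define h where "h x = (if x \<le> n then g x else 0)" for x
  define d where "d t = h t - h (Suc t)" for t
  have d_nonneg: "0 \<le> d t" if "t \<in> {1..n}" for t
    using that mono nonneg by (cases "t = n") (auto simp: d_def h_def)
  have tel: "h x - h y = (\<Sum>t\<in>{1..n}. if x \<le> t \<and> t < y then d t else 0)"
    if "1 \<le> x" "x \<le> y" "y \<le> Suc n" for x y
  proof -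
    have "(\<Sum>t\<in>{1..n}. if x \<le> t \<and> t < y then d t else 0) = (\<Sum>t\<in>{x..<y}. d t)"
      using that by (subst sum.inter_filter[symmetric]) (auto intro!: sum.cong)
    also have "\<dots> = h x - h y"
      using sum_Suc_diff'[OF that(2), of h] by (simp add: d_def sum_subtractf)
    finally show ?thesis by simp
  qed
  have "(\<Sum>x\<in>{1..n}. g x) - (\<Sum>x\<in>{1..n}. g (next_point B x))
      = (\<Sum>x\<in>{1..n}. h x - h (next_point B x))"
    unfolding sum_subtractf[symmetric]
    by (intro sum.cong) (use next_point[OF nB] in \<open>auto simp: h_def\<close>)
  also have "\<dots> = (\<Sum>x\<in>{1..n}. \<Sum>t\<in>{1..n}. if x \<le> t \<and> t < next_point B x then d t else 0)"
    by (intro sum.cong refl tel) (use next_point[OF nB] in \<open>auto simp: le_Suc_eq\<close>)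
  also have "\<dots> = (\<Sum>t\<in>{1..n}. \<Sum>x\<in>{1..n}. if x \<le> t \<and> t < next_point B x then d t else 0)"
    by (rule sum.swap)
  also have "\<dots> = (\<Sum>t\<in>{1..n}. real (card {x\<in>{1..n}. x \<le> t \<and> t < next_point B x}) * d t)"
    by (simp add: sum.inter_filter[symmetric])
  also have "\<dots> \<le> (\<Sum>t\<in>{1..n}. (\<alpha> * real t) * d t)"
  proof (intro sum_mono mult_right_mono d_nonneg)
    fix t assume t: "t \<in> {1..n}"
    then obtain b where b: "b \<in> B" "b \<le> t" "real t - real b \<le> \<alpha> * real t" using B by blast
    have "{x\<in>{1..n}. x \<le> t \<and> t < next_point B x} \<subseteq> {b<..t}"
      using next_point_le[OF b(1)] b(2) by (force simp: not_le[symmetric])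
    then have "card {x\<in>{1..n}. x \<le> t \<and> t < next_point B x} \<le> t - b"
      using card_mono[of "{b<..t}"] by fastforce
    with b show "real (card {x\<in>{1..n}. x \<le> t \<and> t < next_point B x}) \<le> \<alpha> * real t"
      by linarith
  qed
  also have "\<dots> = \<alpha> * (\<Sum>t\<in>{1..n}. \<Sum>x\<in>{1..n}. if x \<le> t then d t else 0)"
  proof -
    have "real t * d t = (\<Sum>x\<in>{1..n}. if x \<le> t then d t else 0)" if "t \<in> {1..n}" for t
    proof -
      have "{x\<in>{1..n}. x \<le> t} = {1..t}" using that by auto
      then show ?thesis by (simp add: sum.inter_filter[symmetric])
    qed
    then show ?thesis by (simp add: sum_distrib_left mult.assoc)
  qed
  also have "(\<Sum>t\<in>{1..n}. \<Sum>x\<in>{1..n}. if x \<le> t then d t else 0)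
      = (\<Sum>x\<in>{1..n}. \<Sum>t\<in>{1..n}. if x \<le> t then d t else 0)"
    by (rule sum.swap)
  also have "\<dots> = (\<Sum>x\<in>{1..n}. g x)"
  proof (intro sum.cong refl)
    fix x assume x: "x \<in> {1..n}"
    have "(\<Sum>t\<in>{1..n}. if x \<le> t then d t else 0)
        = (\<Sum>t\<in>{1..n}. if x \<le> t \<and> t < Suc n then d t else 0)"
      by (intro sum.cong) auto
    also have "\<dots> = g x" using tel[of x "Suc n"] x by (simp add: h_def)
    finally show "(\<Sum>t\<in>{1..n}. if x \<le> t then d t else 0) = g x" .
  qed
  finally show ?thesis .
qed

section \<open>The geometric grid of query points\<close>

text \<open>The leading \<open>n\<close> guarantees a next point for every \<open>x \<le> n\<close>.
  The range of exponents is long enough to contain every power up to \<open>n\<close> when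
  \<open>\<alpha> \<le> 1/2\<close>; the filter keeps the queries inside the domain. Repeated points
  are harmless.\<close>

definition breakpoints :: "nat \<Rightarrow> real \<Rightarrow> nat list" where
  "breakpoints n \<alpha> = n # filter (\<lambda>b. b \<le> n)
     (map (\<lambda>i. nat \<lceil>(1 + \<alpha>) ^ i\<rceil>) [0..<Suc (nat \<lfloor>2 * log 2 (real n) / \<alpha>\<rfloor>)])"

lemma set_breakpoints:
  assumes "n \<ge> 1" "0 < \<alpha>"
  shows "set (breakpoints n \<alpha>) \<subseteq> {1..n}"
  using assms by (auto simp: breakpoints_def Suc_le_eq)

lemma length_breakpoints:
  assumes "n \<ge> 1" "0 < \<alpha>"
  shows "real (length (breakpoints n \<alpha>)) \<le> 2 * log 2 (real n) / \<alpha> + 2"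
proof -
  have "length (breakpoints n \<alpha>) \<le> 2 + nat \<lfloor>2 * log 2 (real n) / \<alpha>\<rfloor>"
    unfolding breakpoints_def list.size
    using length_filter_le[of "\<lambda>b. b \<le> n"
        "map (\<lambda>i. nat \<lceil>(1 + \<alpha>) ^ i\<rceil>) [0..<Suc (nat \<lfloor>2 * log 2 (real n) / \<alpha>\<rfloor>)]"]
    by (simp only: length_map length_upt)
  moreover have "0 \<le> 2 * log 2 (real n) / \<alpha>" using assms by simp
  ultimately show ?thesis by linarith
qed

text \<open>Take logarithms: \<open>ln (1 + \<alpha>) \<ge> \<alpha> - \<alpha>^2 \<ge>
  \<alpha>/2\<close> for \<open>\<alpha> \<le> 1/2\<close>, and \<open>ln x \<le> log 2 x\<close>
  because \<open>x \<ge> 1\<close> and \<open>ln 2 \<le> 1\<close>.\<close>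

lemma power_le_imp_exponent_le:
  fixes \<alpha> x :: real
  assumes "0 < \<alpha>" "\<alpha> \<le> 1/2" "(1 + \<alpha>) ^ i \<le> x"
  shows "real i \<le> 2 * log 2 x / \<alpha>"
proof -
  have x1: "1 \<le> x" using assms one_le_power[of "1 + \<alpha>" i] by linarith
  have "\<alpha> * \<alpha> \<le> \<alpha> * (1/2)" using assms by (intro mult_left_mono) auto
  then have "\<alpha> * \<alpha> \<le> \<alpha> / 2" by simp
  then have "\<alpha> / 2 \<le> ln (1 + \<alpha>)"
    using ln_one_plus_pos_lower_bound[of \<alpha>] assms unfolding power2_eq_square by linarith
  then have "real i * (\<alpha> / 2) \<le> real i * ln (1 + \<alpha>)" by (intro mult_left_mono) auto
  also have "\<dots> = ln ((1 + \<alpha>) ^ i)" using assms by (simp add: ln_realpow)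
  also have "\<dots> \<le> ln x" using assms x1 by (subst ln_le_cancel_iff) auto
  also have "\<dots> \<le> log 2 x"
  proof -
    have "ln (2::real) \<le> 1" using ln_le_minus_one[of "2::real"] by simp
    then have "ln x * ln 2 \<le> ln x * 1" using x1 by (intro mult_left_mono) auto
    then show ?thesis by (simp add: log_def field_simps)
  qed
  finally show ?thesis using assms by (simp add: field_simps)
qed

text \<open>Let \<open>t\<close> lie between two consecutive powers of \<open>1 + \<alpha>\<close>.
  Rounding the lower power up to \<open>b\<close> does not pass the integer \<open>t\<close>, and
  \<open>t < (1 + \<alpha>) * b\<close> gives a gap below
  \<open>\<alpha> * b \<le> \<alpha> * t\<close>.\<close>

lemma breakpoints_dense:
  assumes "0 < \<alpha>" "\<alpha> \<le> 1/2" "t \<in> {1..n}"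
  shows "\<exists>b\<in>set (breakpoints n \<alpha>). b \<le> t \<and> real t - real b \<le> \<alpha> * real t"
proof -
  obtain i where i: "(1 + \<alpha>) ^ i \<le> real t" "real t < (1 + \<alpha>) ^ Suc i"
  proof -
    obtain N where N: "real t < (1 + \<alpha>) ^ N" using real_arch_pow[of "1 + \<alpha>"] assms by auto
    have "\<not> real t < (1 + \<alpha>) ^ 0" using assms by auto
    then have "\<exists>k<N. (\<forall>i\<le>k. \<not> real t < (1 + \<alpha>) ^ i) \<and> real t < (1 + \<alpha>) ^ Suc k"
      by (intro ex_least_nat_less[of "\<lambda>i. real t < (1 + \<alpha>) ^ i"] N)
    then show ?thesis using that by (meson le_refl not_le)
  qed
  define b where "b = nat \<lceil>(1 + \<alpha>) ^ i\<rceil>"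
  have b_ge: "(1 + \<alpha>) ^ i \<le> real b" unfolding b_def by (rule real_nat_ceiling_ge)
  have b_le: "b \<le> t" using i(1) by (simp add: b_def ceiling_le_iff)
  have "real i \<le> 2 * log 2 (real n) / \<alpha>"
    using i(1) assms by (intro power_le_imp_exponent_le) auto
  then have "i < Suc (nat \<lfloor>2 * log 2 (real n) / \<alpha>\<rfloor>)"
    by (simp add: less_Suc_eq_le le_nat_floor)
  then have "b \<in> set (breakpoints n \<alpha>)"
    using b_le assms by (auto simp: breakpoints_def b_def simp del: upt_Suc)
  moreover have "real t - real b \<le> \<alpha> * real t"
  proof -
    have "real t < (1 + \<alpha>) * real b"
      using i(2) mult_left_mono[OF b_ge, of "1 + \<alpha>"] assms(1) unfolding power_Suc by linarith
    also have "\<dots> \<le> real b + \<alpha> * real t" using b_le assms by (simp add: distrib_right)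
    finally show ?thesis by simp
  qed
  ultimately show ?thesis using b_le by blast
qed

subsection \<open>Normalising a step function\<close>

text \<open>Meaningful only for \<open>f\<close> nonnegative on \<open>{1..n}\<close> with positive
  mass; the tester uses it only after \<open>plausible\<close> has ensured the latter.\<close>

definition normalised :: "nat \<Rightarrow> (nat \<Rightarrow> real) \<Rightarrow> nat pmf" where
  "normalised n f = embed_pmf (\<lambda>x. if x \<in> {1..n} then f x / (\<Sum>y\<in>{1..n}. f y) else 0)"

lemma pmf_normalised:
  assumes "\<And>x. x \<in> {1..n} \<Longrightarrow> 0 \<le> f x" "0 < (\<Sum>y\<in>{1..n}. f y)"
  shows "pmf (normalised n f) x = (if x \<in> {1..n} then f x / (\<Sum>y\<in>{1..n}. f y) else 0)"
  unfolding normalised_def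
proof (rule pmf_embed_pmf)
  let ?g = "\<lambda>x. if x \<in> {1..n} then f x / (\<Sum>y\<in>{1..n}. f y) else 0"
  show nonneg: "0 \<le> ?g x" for x using assms by auto
  have "(\<integral>\<^sup>+ x. ennreal (?g x) \<partial>count_space UNIV) = (\<Sum>x\<in>{1..n}. ennreal (?g x))"
    by (intro nn_integral_count_space') (auto split: if_splits)
  also have "\<dots> = ennreal (\<Sum>x\<in>{1..n}. ?g x)" using nonneg by (intro sum_ennreal)
  also have "(\<Sum>x\<in>{1..n}. ?g x) = 1"
    using assms(2) by (simp add: sum_divide_distrib[symmetric])
  finally show "(\<integral>\<^sup>+ x. ennreal (?g x) \<partial>count_space UNIV) = 1" by simp
qed

lemma set_normalised:
  assumes "\<And>x. x \<in> {1..n} \<Longrightarrow> 0 \<le> f x" "0 < (\<Sum>y\<in>{1..n}. f y)"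
  shows "set_pmf (normalised n f) \<subseteq> {1..n}"
  using pmf_normalised[of n f] assms by (auto simp: set_pmf_iff split: if_splits)

text \<open>Both masses are 1, so the positive and negative parts of the difference have equal sums.
  The one-sided form suits a test that looks only for points where \<open>D\<close> is too
  small.\<close>

lemma d_TV_eq_sum_max:
  assumes "D1 \<in> distributions n" "D2 \<in> distributions n"
  shows "d_TV n D1 D2 = (\<Sum>x\<in>{1..n}. max 0 (pmf D2 x - pmf D1 x))"
proof -
  have "2 * (\<Sum>x\<in>{1..n}. max 0 (pmf D2 x - pmf D1 x))
      = (\<Sum>x\<in>{1..n}. \<bar>pmf D1 x - pmf D2 x\<bar> + (pmf D2 x - pmf D1 x))"
    by (subst sum_distrib_left) (auto intro!: sum.cong simp: max_def)
  also have "\<dots> = 2 * d_TV n D1 D2"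
    using pmf_sum_eq_1[OF assms(1)] pmf_sum_eq_1[OF assms(2)]
    by (simp only: sum.distrib sum_subtractf d_TV_def)
  finally show ?thesis by simp
qed

lemma d_TV_class_le: "D' \<in> P \<Longrightarrow> d_TV_class n D P \<le> d_TV n D D'"
  unfolding d_TV_class_def
  by (rule cINF_lower) (auto intro!: bdd_belowI[of _ 0] sum_nonneg simp: d_TV_def)

text \<open>
  Where \<open>D \<ge> f\<close>, the normalisation of \<open>f\<close> exceeds \<open>D\<close> by at most the fraction \<open>\<alpha>\<close> of its own value,
  so a large distance must come from the points with \<open>D < f\<close>.
\<close>
lemma prob_below_ge:
  assumes D: "D \<in> distributions n"
    and nonneg: "\<And>x. x \<in> {1..n} \<Longrightarrow> 0 \<le> f x"
    and mono: "\<forall>i\<in>{1..<n}. f i \<ge> f (Suc i)"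
    and mass: "1 - \<alpha> \<le> (\<Sum>y\<in>{1..n}. f y)" and \<alpha>: "0 \<le> \<alpha>" "\<alpha> < 1"
    and far: "\<epsilon> \<le> d_TV_class n D (monotone_dists n)"
  shows "\<epsilon> - \<alpha> \<le> measure_pmf.prob (normalised n f) {x. pmf D x < f x}"
proof -
  let ?p = "normalised n f" and ?w = "\<Sum>y\<in>{1..n}. f y"
  have w: "0 < ?w" using mass \<alpha> by linarith
  note p = pmf_normalised[OF nonneg w, simplified]
  have pd: "?p \<in> distributions n" using set_normalised[OF nonneg w] by (simp add: distributions_def)
  have "?p \<in> monotone_dists n"
    using pd mono w by (auto simp: monotone_dists_def p intro!: divide_right_mono)
  then have "\<epsilon> \<le> (\<Sum>x\<in>{1..n}. max 0 (pmf ?p x - pmf D x))"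
    using far d_TV_class_le[of ?p "monotone_dists n" n D] d_TV_eq_sum_max[OF D pd] by linarith
  also have "\<dots> \<le> (\<Sum>x\<in>{1..n}. (if pmf D x < f x then pmf ?p x else 0) + \<alpha> * pmf ?p x)"
  proof (rule sum_mono)
    fix x assume x: "x \<in> {1..n}"
    have f: "f x = pmf ?p x * ?w" using x w by (simp add: p)
    have "pmf ?p x * (1 - \<alpha>) \<le> f x" unfolding f using mass by (intro mult_left_mono) auto
    then have "pmf ?p x - f x \<le> \<alpha> * pmf ?p x" by (simp add: algebra_simps)
    then show "max 0 (pmf ?p x - pmf D x) \<le> (if pmf D x < f x then pmf ?p x else 0) + \<alpha> * pmf ?p x"
      using pmf_nonneg[of D x] pmf_nonneg[of ?p x] mult_nonneg_nonneg[OF \<alpha>(1) pmf_nonneg[of ?p x]]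
      by (cases "pmf D x < f x"; simp only: if_True if_False; linarith)
  qed
  also have "\<dots> = (\<Sum>x\<in>{x\<in>{1..n}. pmf D x < f x}. pmf ?p x) + \<alpha> * (\<Sum>x\<in>{1..n}. pmf ?p x)"
    by (simp only: sum.distrib sum_distrib_left[symmetric] sum.inter_filter[OF finite_atLeastAtMost])
  also have "(\<Sum>x\<in>{x\<in>{1..n}. pmf D x < f x}. pmf ?p x)
      = measure_pmf.prob ?p {x\<in>{1..n}. pmf D x < f x}"
    by (rule measure_measure_pmf_finite[symmetric]) auto
  also have "\<dots> \<le> measure_pmf.prob ?p {x. pmf D x < f x}"
    by (intro measure_pmf.finite_measure_mono) auto
  finally show ?thesis using pmf_sum_eq_1[OF pd] by simp
qed

subsection \<open>The tester\<close>

lemma verdict_prob_eq: "verdict_prob D A v = pmf (map_pmf fst (run D A)) v"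
  by (auto simp: verdict_prob_def pmf_map intro!: arg_cong[where f = "measure_pmf.prob _"])

text \<open>Written with a continuation because the algorithms are decision trees: the answers are
  collected in a table with default 0, on which the rest of the tree depends.\<close>

fun query_list :: "nat list \<Rightarrow> ((nat \<Rightarrow> real) \<Rightarrow> eval_alg) \<Rightarrow> eval_alg" where
  "query_list [] k = k (\<lambda>_. 0)"
| "query_list (x # xs) k = Query x (\<lambda>y. query_list xs (\<lambda>h. k (h(x := y))))"

lemma run_query_list:
  "run D (query_list xs k) =
     map_pmf (\<lambda>(v, qs). (v, xs @ qs)) (run D (k (\<lambda>x. if x \<in> set xs then pmf D x else 0)))"
proof (induction xs arbitrary: k)
  case Nil
  show ?case by (simp add: case_prod_unfold)
next
  case (Cons x xs)
  have "(\<lambda>z. if z \<in> set xs then pmf D z else 0)(x := pmf D x)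
      = (\<lambda>z. if z \<in> set (x # xs) then pmf D z else 0)" by auto
  then show ?case by (simp add: Cons map_pmf_comp case_prod_unfold)
qed

fun spot_check :: "nat \<Rightarrow> nat pmf \<Rightarrow> (nat \<Rightarrow> real) \<Rightarrow> eval_alg" where
  "spot_check 0 p f = Output ACCEPT"
| "spot_check (Suc m) p f =
     Sample p (\<lambda>x. Query x (\<lambda>y. if y < f x then Output REJECT else spot_check m p f))"

lemma spot_check_queries:
  assumes "(v, qs) \<in> set_pmf (run D (spot_check m p f))"
  shows "set qs \<subseteq> set_pmf p \<and> length qs \<le> m"
  using assms by (induction m arbitrary: v qs) (fastforce split: if_splits)+

lemma spot_check_accepts:
  assumes "\<And>x. x \<in> set_pmf p \<Longrightarrow> f x \<le> pmf D x"
  shows "map_pmf fst (run D (spot_check m p f)) = return_pmf ACCEPT"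
proof (induction m)
  case (Suc m)
  have "map_pmf fst (run D (spot_check (Suc m) p f))
      = bind_pmf p (\<lambda>x. map_pmf fst
          (run D (if pmf D x < f x then Output REJECT else spot_check m p f)))"
    by (simp add: map_bind_pmf map_pmf_comp case_prod_unfold)
  also have "\<dots> = bind_pmf p (\<lambda>_. return_pmf ACCEPT)"
    by (rule bind_pmf_cong) (use assms in \<open>auto simp: Suc not_less[symmetric]\<close>)
  finally have "map_pmf fst (run D (spot_check (Suc m) p f)) = bind_pmf p (\<lambda>_. return_pmf ACCEPT)" .
  then show ?case by simp
qed simp

text \<open>The rounds are independent, so all \<open>m\<close> samples miss the bad set with
  probability \<open>(1 - q) ^ m\<close>, where \<open>q\<close> is its probability under
  \<open>p\<close>.\<close>

lemma spot_check_rejects: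
  "pmf (map_pmf fst (run D (spot_check m p f))) REJECT
     = 1 - (1 - measure_pmf.prob p {x. pmf D x < f x}) ^ m"
proof (induction m)
  case (Suc m)
  let ?S = "{x. pmf D x < f x}" and ?q = "measure_pmf.prob p {x. pmf D x < f x}"
  \<comment> \<open>Both branches are merged into one affine expression in the indicator of the bad
    set, so the expectation over the first sample follows by linearity.\<close>
  have *: "pmf (map_pmf fst (run D (if pmf D x < f x then Output REJECT else spot_check m p f))) REJECT
      = (1 - (1 - ?q) ^ m) + (1 - ?q) ^ m * indicator ?S x" for x
    by (simp add: Suc)
  have "pmf (map_pmf fst (run D (spot_check (Suc m) p f))) REJECT
      = measure_pmf.expectation p (\<lambda>x. (1 - (1 - ?q) ^ m) + (1 - ?q) ^ m * indicator ?S x)"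
    by (simp only: spot_check.simps run.simps map_bind_pmf map_pmf_comp case_prod_unfold fst_conv
        pmf_bind *)
  also have "\<dots> = (1 - (1 - ?q) ^ m) + (1 - ?q) ^ m * ?q"
    by (subst Bochner_Integration.integral_add)
      (auto simp: measure_pmf.prob_space intro!: measure_pmf.integrable_const_bound[where B = 1])
  finally show ?case by (simp add: algebra_simps)
qed simp

definition step_function :: "nat \<Rightarrow> real \<Rightarrow> (nat \<Rightarrow> real) \<Rightarrow> nat \<Rightarrow> real" where
  "step_function n \<alpha> h x = h (next_point (set (breakpoints n \<alpha>)) x)"

definition plausible :: "nat \<Rightarrow> real \<Rightarrow> (nat \<Rightarrow> real) \<Rightarrow> bool" where
  "plausible n \<alpha> f \<longleftrightarrow> (\<forall>i\<in>{1..<n}. f i \<ge> f (Suc i)) \<and> 1 - \<alpha> \<le> (\<Sum>y\<in>{1..n}. f y)"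

text \<open>With \<open>\<alpha> = \<epsilon>/2\<close> a sample is bad with probability at least
  \<open>\<epsilon>/2\<close> in the far case, so \<open>4/\<epsilon>\<close> samples all miss with
  probability at most \<open>exp (- 2)\<close>.\<close>

definition mono_tester :: "nat \<Rightarrow> real \<Rightarrow> eval_alg" where
  "mono_tester n \<epsilon> = query_list (breakpoints n (\<epsilon>/2)) (\<lambda>h.
     let f = step_function n (\<epsilon>/2) h
     in if plausible n (\<epsilon>/2) f then spot_check (nat \<lceil>4/\<epsilon>\<rceil>) (normalised n f) f
        else Output REJECT)"

section \<open>Query count and correctness for a fixed distribution\<close>

context
  fixes n :: nat and \<epsilon> :: real and D :: "nat pmf" and f :: "nat \<Rightarrow> real"
  assumes n: "n \<ge> 1" and \<epsilon>: "0 < \<epsilon>" "\<epsilon> \<le> 1" and D: "D \<in> distributions n"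
  defines "f \<equiv> step_function n (\<epsilon>/2)
    (\<lambda>x. if x \<in> set (breakpoints n (\<epsilon>/2)) then pmf D x else 0)"
begin

private lemma n_breakpoint: "n \<in> set (breakpoints n (\<epsilon>/2))"
  by (simp add: breakpoints_def)

text \<open>The next point of any \<open>x \<le> n\<close> is a breakpoint, so the default 0 of the
  answer table is never read.\<close>

private lemma f_eq: "x \<in> {1..n} \<Longrightarrow> f x = pmf D (next_point (set (breakpoints n (\<epsilon>/2))) x)"
  using next_point[OF n_breakpoint] by (auto simp: f_def step_function_def)

private lemma f_nonneg: "x \<in> {1..n} \<Longrightarrow> 0 \<le> f x"
  by (simp add: f_eq)

private lemma run_mono_tester:
  "run D (mono_tester n \<epsilon>) = map_pmf (\<lambda>(v, qs). (v, breakpoints n (\<epsilon>/2) @ qs))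
     (run D (if plausible n (\<epsilon>/2) f then spot_check (nat \<lceil>4/\<epsilon>\<rceil>) (normalised n f) f
             else Output REJECT))"
  by (simp add: mono_tester_def run_query_list f_def Let_def)

private lemma plausible_mass: "plausible n (\<epsilon>/2) f \<Longrightarrow> 0 < (\<Sum>y\<in>{1..n}. f y)"
  using \<epsilon> by (auto simp: plausible_def)

lemma mono_tester_queries:
  assumes "(v, qs) \<in> set_pmf (run D (mono_tester n \<epsilon>))"
  shows "set qs \<subseteq> {1..n}"
    and "real (length qs) \<le> 11 * max (log 2 (real n) / \<epsilon>) (1 / \<epsilon>^2)"
proof -
  from assms obtain qs' where qs: "qs = breakpoints n (\<epsilon>/2) @ qs'"
    and qs': "(v, qs') \<in> set_pmf (run D (if plausible n (\<epsilon>/2) f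
      then spot_check (nat \<lceil>4/\<epsilon>\<rceil>) (normalised n f) f else Output REJECT))"
    unfolding run_mono_tester by auto
  have "set qs' \<subseteq> {1..n} \<and> length qs' \<le> nat \<lceil>4/\<epsilon>\<rceil>"
  proof (cases "plausible n (\<epsilon>/2) f")
    case True
    then show ?thesis
      using qs' spot_check_queries set_normalised[OF f_nonneg plausible_mass[OF True]] by fastforce
  qed (use qs' in auto)
  then have s: "set qs' \<subseteq> {1..n}" and l: "length qs' \<le> nat \<lceil>4/\<epsilon>\<rceil>" by auto
  show "set qs \<subseteq> {1..n}" using s set_breakpoints[of n "\<epsilon>/2"] n \<epsilon> by (auto simp: qs)
  let ?M = "max (log 2 (real n) / \<epsilon>) (1 / \<epsilon>^2)"
  have "real (length qs') \<le> 4/\<epsilon> + 1"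
  proof -
    have "0 \<le> 4/\<epsilon>" using \<epsilon> by simp
    then show ?thesis using l by linarith
  qed
  moreover have "real (length (breakpoints n (\<epsilon>/2))) \<le> 4 * (log 2 (real n) / \<epsilon>) + 2"
    using length_breakpoints[of n "\<epsilon>/2"] n \<epsilon> by simp
  moreover have "1/\<epsilon> \<le> 1/\<epsilon>^2" "1 \<le> 1/\<epsilon>"
    using \<epsilon> by (auto simp: field_simps power2_eq_square)
  moreover have "log 2 (real n) / \<epsilon> \<le> ?M" "1/\<epsilon>^2 \<le> ?M" by auto
  \<comment> \<open>The total is at most
    \<open>4 * (log 2 n / \<epsilon>) + 2 + 4/\<epsilon> + 1\<close>. Since
    \<open>1 \<le> 1/\<epsilon> \<le> 1/\<epsilon>^2 \<le> ?M\<close>, this is at most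
    \<open>(4 + 4 + 3) * ?M\<close>.\<close>
  ultimately show "real (length qs) \<le> 11 * ?M" unfolding qs length_append of_nat_add
    by (simp del: max.bounded_iff)
qed

private lemma map_fst_run: "map_pmf fst (run D (mono_tester n \<epsilon>)) = map_pmf fst
    (run D (if plausible n (\<epsilon>/2) f then spot_check (nat \<lceil>4/\<epsilon>\<rceil>) (normalised n f) f
            else Output REJECT))"
  by (simp add: run_mono_tester map_pmf_comp case_prod_unfold)

lemma mono_tester_accepts:
  assumes "D \<in> monotone_dists n"
  shows "verdict_prob D (mono_tester n \<epsilon>) ACCEPT = 1"
proof -
  have mono: "\<forall>i\<in>{1..<n}. pmf D i \<ge> pmf D (Suc i)"
    using assms by (simp add: monotone_dists_def)
  have f_le: "f x \<le> pmf D x" if "x \<in> {1..n}" for x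
    using that next_point[OF n_breakpoint, of x]
    by (auto simp: f_eq intro!: antimono_from_steps[OF mono])
  have "f (Suc i) \<le> f i" if "i \<in> {1..<n}" for i
    using that next_point[OF n_breakpoint, of i] next_point[OF n_breakpoint, of "Suc i"]
      next_point_mono[OF n_breakpoint, of i "Suc i"]
    by (auto simp: f_eq intro!: antimono_from_steps[OF mono])
  \<comment> \<open>The grid is dense with ratio \<open>\<epsilon>/2 \<le> 1/2\<close>, and
    \<open>D\<close> has total mass 1.\<close>
  moreover have "1 - \<epsilon>/2 \<le> (\<Sum>y\<in>{1..n}. f y)"
    using step_function_mass[OF n_breakpoint _ mono pmf_nonneg, of "\<epsilon>/2"]
      breakpoints_dense[of "\<epsilon>/2" _ n] \<epsilon> pmf_sum_eq_1[OF D]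
    by (simp add: f_eq)
  ultimately have pl: "plausible n (\<epsilon>/2) f" by (simp add: plausible_def)
  have "f x \<le> pmf D x" if "x \<in> set_pmf (normalised n f)" for x
    using that set_normalised[OF f_nonneg plausible_mass[OF pl]] f_le by blast
  then show ?thesis
    by (simp add: verdict_prob_eq map_fst_run pl spot_check_accepts)
qed

lemma mono_tester_rejects:
  assumes "\<epsilon> \<le> d_TV_class n D (monotone_dists n)"
  shows "2/3 \<le> verdict_prob D (mono_tester n \<epsilon>) REJECT"
proof (cases "plausible n (\<epsilon>/2) f")
  case True
  define m where "m = nat \<lceil>4/\<epsilon>\<rceil>"
  let ?q = "measure_pmf.prob (normalised n f) {x. pmf D x < f x}"
  have "\<epsilon> - \<epsilon>/2 \<le> ?q"
    using True \<epsilon> by (intro prob_below_ge[OF D f_nonneg _ _ _ _ assms]) (auto simp: plausible_def)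
  \<comment> \<open>Uses
    \<open>1 - ?q \<le> 1 - \<epsilon>/2 \<le> exp (- (\<epsilon>/2))\<close>.\<close>
  then have "(1 - ?q) ^ m \<le> exp (- (\<epsilon>/2)) ^ m"
    using exp_ge_add_one_self[of "- (\<epsilon>/2)"] by (intro power_mono) auto
  also have "\<dots> = exp (- (real m * \<epsilon> / 2))" by (simp add: exp_of_nat_mult[symmetric])
  also have "\<dots> \<le> exp (- 2)"
  proof -
    have "4/\<epsilon> \<le> real m" unfolding m_def by (rule real_nat_ceiling_ge)
    then show ?thesis using \<epsilon> by (simp add: field_simps)
  qed
  \<comment> \<open>From \<open>exp 2 \<ge> 1 + 2\<close>.\<close>
  also have "\<dots> \<le> 1/3"
    using exp_ge_add_one_self[of "2::real"] by (simp add: exp_minus field_simps)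
  finally show ?thesis
    by (simp add: verdict_prob_eq map_fst_run True spot_check_rejects m_def)
qed (simp add: verdict_prob_eq map_fst_run)

end

theorem theorem5p4:
  "\<exists>T. eval_tester monotone_dists T \<and>
     (\<exists>C>0. \<forall>(n::nat) (\<epsilon>::real). n \<ge> 1 \<and> 0 < \<epsilon> \<and> \<epsilon> \<le> 1 \<longrightarrow>
        queries_at_most n (T n \<epsilon>) (C * max (log 2 (real n) / \<epsilon>) (1 / \<epsilon>^2)))"
proof (intro exI[of _ mono_tester] conjI exI[of _ 11])
  show "eval_tester monotone_dists mono_tester"
    unfolding eval_tester_def legal_queries_def
  proof (intro allI impI conjI ballI)
    fix n :: nat and \<epsilon> :: real and D r
    assume *: "n \<ge> 1 \<and> 0 < \<epsilon> \<and> \<epsilon> \<le> 1" "D \<in> distributions n"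
    show "case r of (v, qs) \<Rightarrow> set qs \<subseteq> {1..n}" if "r \<in> set_pmf (run D (mono_tester n \<epsilon>))"
      using mono_tester_queries(1)[of n \<epsilon> D] * that by (cases r) blast
    show "2/3 \<le> verdict_prob D (mono_tester n \<epsilon>) ACCEPT" if "D \<in> monotone_dists n"
      using mono_tester_accepts[of n \<epsilon> D] * that by simp
    show "2/3 \<le> verdict_prob D (mono_tester n \<epsilon>) REJECT"
      if "\<epsilon> \<le> d_TV_class n D (monotone_dists n)"
      using mono_tester_rejects[of n \<epsilon> D] * that by blast
  qed
  show "\<forall>(n::nat) (\<epsilon>::real). n \<ge> 1 \<and> 0 < \<epsilon> \<and> \<epsilon> \<le> 1 \<longrightarrow>
      queries_at_most n (mono_tester n \<epsilon>) (11 * max (log 2 (real n) / \<epsilon>) (1 / \<epsilon>^2))"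
    unfolding queries_at_most_def using mono_tester_queries(2) by blast
qed simp

end
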